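(* Let $M$ be an ultrametric space (with a distinguished point $0\in M$). Then the closed unit ball $B_{\mathrm{Lip}_0(M)}$ contains a strongly extreme point, and in particular $\mathrm{Lip}_0(M)$ is not locally almost square.
   Context: All Banach spaces are real; $B_X$ and $S_X$ denote the closed unit ball and unit sphere of a Banach space $X$. All metric spaces are pointed, that is, they have a distinguished point $0$. A metric space $(M,d)$ is ultrametric if $d(x,y)\le\max\{d(x,z),d(z,y)\}$ for all $x,y,z\in M$. $\mathrm{Lip}_0(M)$ is the Banach space of all Lipschitz functions $f\colon M\to\mathbb{R}$ with $f(0)=0$, with norm $\|f\|=\sup\{|f(x)-f(y)|/d(x,y): x,y\in M,\ x\ne y\}$. A point $x\in S_X$ is a strongly extreme point (of $B_X$) if for every sequence $(y_n)$ in $X$, $\lim_n\|x\pm y_n\|=1$ (for both choices of sign) implies $\lim_n\|y_n\|=0$. A Banach space $X$ is locally almost square (LASQ) if for every $x\in S_X$ and $\varepsilon>0$ there is $y\in S_X$ such that $\|x\pm y\|\le1+\varepsilon$ (for both choices of sign). *)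

theory Defs
  imports "HOL-Analysis.Analysis" "HOL-Library.Function_Algebras"
begin

section \<open>Real Banach spaces given by a carrier and a norm\<close>

text \<open>The space of Lipschitz functions depends on a metric space and a base point that are terms,
  so it cannot be an instance of the type class for Banach spaces.  A normed space is therefore
  a linear subspace \<open>X\<close> of some real vector space together with a norm function \<open>N\<close> on it.\<close>

instantiation "fun" :: (type, real_vector) real_vector
begin

definition scaleR_fun :: "real \<Rightarrow> ('a \<Rightarrow> 'b) \<Rightarrow> 'a \<Rightarrow> 'b" where
  "scaleR_fun c f = (\<lambda>x. c *\<^sub>R f x)"

instance
  by standard (auto simp: scaleR_fun_def fun_eq_iff scaleR_add_right scaleR_add_left)

end

lemma scaleR_fun_apply [simp]: "(c *\<^sub>R f) x = c *\<^sub>R f x"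
  by (simp add: scaleR_fun_def)

definition normed_space_on :: "'v::real_vector set \<Rightarrow> ('v \<Rightarrow> real) \<Rightarrow> bool" where
  "normed_space_on X N \<longleftrightarrow> subspace X \<and>
     (\<forall>x\<in>X. 0 \<le> N x \<and> (N x = 0 \<longleftrightarrow> x = 0)) \<and>
     (\<forall>x\<in>X. \<forall>c. N (c *\<^sub>R x) = \<bar>c\<bar> * N x) \<and>
     (\<forall>x\<in>X. \<forall>y\<in>X. N (x + y) \<le> N x + N y)"

definition banach_space_on :: "'v::real_vector set \<Rightarrow> ('v \<Rightarrow> real) \<Rightarrow> bool" where
  "banach_space_on X N \<longleftrightarrow>
     normed_space_on X N \<and>
     (\<forall>x :: nat \<Rightarrow> 'v. range x \<subseteq> X \<longrightarrow>
        (\<forall>e>0. \<exists>n0. \<forall>m\<ge>n0. \<forall>n\<ge>n0. N (x m - x n) < e) \<longrightarrow>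
        (\<exists>l\<in>X. (\<lambda>n. N (x n - l)) \<longlonglongrightarrow> 0))"

definition unit_sphere :: "'v::real_vector set \<Rightarrow> ('v \<Rightarrow> real) \<Rightarrow> 'v set" where
  "unit_sphere X N = {x \<in> X. N x = 1}"

definition strongly_extreme_point ::
    "'v::real_vector set \<Rightarrow> ('v \<Rightarrow> real) \<Rightarrow> 'v \<Rightarrow> bool" where
  "strongly_extreme_point X N x \<longleftrightarrow> x \<in> unit_sphere X N \<and>
     (\<forall>y :: nat \<Rightarrow> 'v. range y \<subseteq> X \<longrightarrow>
        (\<lambda>n. N (x + y n)) \<longlonglongrightarrow> 1 \<longrightarrow> (\<lambda>n. N (x - y n)) \<longlonglongrightarrow> 1 \<longrightarrow>
        (\<lambda>n. N (y n)) \<longlonglongrightarrow> 0)"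

definition locally_almost_square :: "'v::real_vector set \<Rightarrow> ('v \<Rightarrow> real) \<Rightarrow> bool" where
  "locally_almost_square X N \<longleftrightarrow>
     (\<forall>x \<in> unit_sphere X N. \<forall>\<epsilon>>0. \<exists>y \<in> unit_sphere X N.
        N (x + y) \<le> 1 + \<epsilon> \<and> N (x - y) \<le> 1 + \<epsilon>)"


section \<open>Ultrametric spaces and spaces of Lipschitz functions\<close>

definition ultrametric_space :: "'a metric \<Rightarrow> bool" where
  "ultrametric_space M \<longleftrightarrow>
     (\<forall>x \<in> mspace M. \<forall>y \<in> mspace M. \<forall>z \<in> mspace M.
        mdist M x y \<le> max (mdist M x z) (mdist M z y))"

text \<open>Functions on the carrier \<open>mspace M\<close> are represented by total functions that vanish off the
  carrier, so that equality and the pointwise operations are those of functions on \<open>mspace M\<close>.\<close>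

definition Lip0 :: "'a metric \<Rightarrow> 'a \<Rightarrow> ('a \<Rightarrow> real) set" where
  "Lip0 M b = {f. Lipschitz_continuous_map M euclidean_metric f \<and> f b = 0 \<and>
                  (\<forall>x. x \<notin> mspace M \<longrightarrow> f x = 0)}"

text \<open>Inserting \<open>0\<close> only matters for a one-point space, where the supremum is over the empty set.\<close>

definition lip_norm :: "'a metric \<Rightarrow> ('a \<Rightarrow> real) \<Rightarrow> real" where
  "lip_norm M f =
     Sup (insert 0 {\<bar>f x - f y\<bar> / mdist M x y | x y. x \<in> mspace M \<and> y \<in> mspace M \<and> x \<noteq> y})"


subsection \<open>The Lipschitz functions form a Banach space\<close>

lemma Lip0_iff:
  "f \<in> Lip0 M b \<longleftrightarrow>
     (\<exists>L. \<forall>x \<in> mspace M. \<forall>y \<in> mspace M. \<bar>f x - f y\<bar> \<le> L * mdist M x y) \<and> f b = 0 \<and>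
     (\<forall>x. x \<notin> mspace M \<longrightarrow> f x = 0)"
  by (auto simp: Lip0_def Lipschitz_continuous_map_def dist_real_def)

lemma lip_norm_le:
  assumes "0 \<le> L"
    and "\<And>x y. x \<in> mspace M \<Longrightarrow> y \<in> mspace M \<Longrightarrow> \<bar>f x - f y\<bar> \<le> L * mdist M x y"
  shows "lip_norm M f \<le> L"
proof -
  have "\<bar>f x - f y\<bar> / mdist M x y \<le> L" if "x \<in> mspace M" "y \<in> mspace M" "x \<noteq> y" for x y
  proof -
    have "mdist M x y > 0" using that by (metis mdist_nonneg mdist_zero less_eq_real_def)
    then show ?thesis using assms(2)[of x y] that by (simp add: divide_le_eq)
  qed
  then show ?thesis
    unfolding lip_norm_def using assms(1) by (intro cSup_least) auto
qed

lemma bdd_above_slopes: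
  assumes "f \<in> Lip0 M b"
  shows "bdd_above
    (insert 0 {\<bar>f x - f y\<bar> / mdist M x y | x y. x \<in> mspace M \<and> y \<in> mspace M \<and> x \<noteq> y})"
proof -
  obtain L where L: "\<forall>x \<in> mspace M. \<forall>y \<in> mspace M. \<bar>f x - f y\<bar> \<le> L * mdist M x y"
    using assms by (auto simp: Lip0_iff)
  have "\<bar>f x - f y\<bar> / mdist M x y \<le> L" if "x \<in> mspace M" "y \<in> mspace M" "x \<noteq> y" for x y
  proof -
    have "mdist M x y > 0" using that by (metis mdist_nonneg mdist_zero less_eq_real_def)
    then show ?thesis using L that by (simp add: divide_le_eq)
  qed
  then show ?thesis by (fastforce intro!: bdd_aboveI[of _ "max 0 L"])
qed

lemma lip_norm_nonneg:
  assumes "f \<in> Lip0 M b"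
  shows "0 \<le> lip_norm M f"
  unfolding lip_norm_def by (rule cSup_upper[OF _ bdd_above_slopes[OF assms]]) simp

lemma lip_norm_bound:
  assumes "f \<in> Lip0 M b" "x \<in> mspace M" "y \<in> mspace M"
  shows "\<bar>f x - f y\<bar> \<le> lip_norm M f * mdist M x y"
proof (cases "x = y")
  case False
  then have pos: "mdist M x y > 0" using assms by (metis mdist_nonneg mdist_zero less_eq_real_def)
  have "\<bar>f x - f y\<bar> / mdist M x y \<le> lip_norm M f"
    unfolding lip_norm_def
    by (rule cSup_upper[OF _ bdd_above_slopes[OF assms(1)]]) (use assms False in auto)
  then show ?thesis using pos by (simp add: divide_le_eq)
next
  case True
  then show ?thesis using lip_norm_nonneg[OF assms(1)] by simp
qed

lemma subspace_Lip0: "subspace (Lip0 M b)"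
proof (rule subspaceI)
  show "0 \<in> Lip0 M b"
    by (auto simp: Lip0_iff intro!: exI[of _ 0])
next
  fix f g assume fg: "f \<in> Lip0 M b" "g \<in> Lip0 M b"
  have "\<bar>(f + g) x - (f + g) y\<bar> \<le> (lip_norm M f + lip_norm M g) * mdist M x y"
    if "x \<in> mspace M" "y \<in> mspace M" for x y
    using lip_norm_bound[OF fg(1) that] lip_norm_bound[OF fg(2) that]
    by (simp add: distrib_right)
  then show "f + g \<in> Lip0 M b"
    using fg by (auto simp: Lip0_iff)
next
  fix c :: real and f assume f: "f \<in> Lip0 M b"
  have "\<bar>(c *\<^sub>R f) x - (c *\<^sub>R f) y\<bar> \<le> (\<bar>c\<bar> * lip_norm M f) * mdist M x y"
    if "x \<in> mspace M" "y \<in> mspace M" for x y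
    using mult_left_mono[OF lip_norm_bound[OF f that] abs_ge_zero[of c]]
    by (simp add: abs_mult[symmetric] right_diff_distrib mult.assoc)
  then show "c *\<^sub>R f \<in> Lip0 M b"
    using f unfolding Lip0_iff by auto
qed

lemma lip_norm_add:
  assumes "f \<in> Lip0 M b" "g \<in> Lip0 M b"
  shows "lip_norm M (f + g) \<le> lip_norm M f + lip_norm M g"
proof (rule lip_norm_le)
  show "0 \<le> lip_norm M f + lip_norm M g"
    using assms by (intro add_nonneg_nonneg lip_norm_nonneg)
  show "\<bar>(f + g) x - (f + g) y\<bar> \<le> (lip_norm M f + lip_norm M g) * mdist M x y"
    if "x \<in> mspace M" "y \<in> mspace M" for x y
    using lip_norm_bound[OF assms(1) that] lip_norm_bound[OF assms(2) that]
    by (simp add: distrib_right)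
qed

lemma lip_norm_scaleR_le:
  assumes "f \<in> Lip0 M b"
  shows "lip_norm M (c *\<^sub>R f) \<le> \<bar>c\<bar> * lip_norm M f"
proof (rule lip_norm_le)
  show "0 \<le> \<bar>c\<bar> * lip_norm M f"
    using lip_norm_nonneg[OF assms] by simp
  show "\<bar>(c *\<^sub>R f) x - (c *\<^sub>R f) y\<bar> \<le> \<bar>c\<bar> * lip_norm M f * mdist M x y"
    if "x \<in> mspace M" "y \<in> mspace M" for x y
    using mult_left_mono[OF lip_norm_bound[OF assms that] abs_ge_zero[of c]]
    by (simp add: abs_mult[symmetric] right_diff_distrib mult.assoc)
qed

lemma lip_norm_zero: "lip_norm M 0 = 0"
proof -
  have "(0 :: 'a \<Rightarrow> real) \<in> Lip0 M undefined" by (rule subspace_0[OF subspace_Lip0])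
  then show ?thesis
    using lip_norm_nonneg[of 0 M undefined] lip_norm_le[of 0 M 0] by fastforce
qed

lemma lip_norm_scaleR:
  assumes "f \<in> Lip0 M b"
  shows "lip_norm M (c *\<^sub>R f) = \<bar>c\<bar> * lip_norm M f"
proof (cases "c = 0")
  case False
  have "lip_norm M (inverse c *\<^sub>R (c *\<^sub>R f)) \<le> \<bar>inverse c\<bar> * lip_norm M (c *\<^sub>R f)"
    by (rule lip_norm_scaleR_le[OF subspace_scale[OF subspace_Lip0 assms]])
  then have "\<bar>c\<bar> * lip_norm M f \<le> lip_norm M (c *\<^sub>R f)"
    using False by (simp add: field_simps)
  then show ?thesis using lip_norm_scaleR_le[OF assms, of c] by simp
qed (simp add: lip_norm_zero)

lemma lip_norm_eq_0_iff:
  assumes "b \<in> mspace M" "f \<in> Lip0 M b"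
  shows "lip_norm M f = 0 \<longleftrightarrow> f = 0"
proof
  assume 0: "lip_norm M f = 0"
  show "f = 0"
  proof
    fix x
    show "f x = 0 x"
      using lip_norm_bound[OF assms(2) _ assms(1), of x] assms(2) 0
      by (cases "x \<in> mspace M") (auto simp: Lip0_iff)
  qed
qed (simp add: lip_norm_zero)

lemma normed_space_on_Lip0:
  assumes "b \<in> mspace M"
  shows "normed_space_on (Lip0 M b) (lip_norm M)"
  unfolding normed_space_on_def
  using subspace_Lip0 lip_norm_nonneg lip_norm_eq_0_iff[OF assms] lip_norm_scaleR lip_norm_add
  by meson

theorem banach_space_on_Lip0:
  assumes b: "b \<in> mspace M"
  shows "banach_space_on (Lip0 M b) (lip_norm M)"
  unfolding banach_space_on_def
proof (intro conjI allI impI)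
  show "normed_space_on (Lip0 M b) (lip_norm M)"
    by (rule normed_space_on_Lip0[OF b])
next
  fix f :: "nat \<Rightarrow> 'a \<Rightarrow> real"
  assume "range f \<subseteq> Lip0 M b"
    and cauchy: "\<forall>e>0. \<exists>n0. \<forall>m\<ge>n0. \<forall>n\<ge>n0. lip_norm M (f m - f n) < e"
  then have f: "f n \<in> Lip0 M b" for n by auto
  have diff: "f m - f n \<in> Lip0 M b" for m n
    by (rule subspace_diff[OF subspace_Lip0 f f])
  have conv: "convergent (\<lambda>n. f n x)" for x
  proof (cases "x \<in> mspace M")
    case True
    have bound: "\<bar>f m x - f n x\<bar> \<le> lip_norm M (f m - f n) * mdist M x b" for m n
      using lip_norm_bound[OF diff True b, of m n] f by (simp add: Lip0_iff)
    have "Cauchy (\<lambda>n. f n x)"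
    proof (rule CauchyI)
      fix e :: real assume e: "e > 0"
      have pos: "mdist M x b + 1 > 0"
        using mdist_nonneg[of M x b] by linarith
      then obtain n0 where n0:
        "\<And>m n. m \<ge> n0 \<Longrightarrow> n \<ge> n0 \<Longrightarrow> lip_norm M (f m - f n) < e / (mdist M x b + 1)"
        using cauchy e by (metis divide_pos_pos)
      have "norm (f m x - f n x) < e" if "m \<ge> n0" "n \<ge> n0" for m n
      proof -
        have "norm (f m x - f n x) \<le> lip_norm M (f m - f n) * (mdist M x b + 1)"
          using bound[of m n] lip_norm_nonneg[OF diff[of m n]] by (simp add: distrib_left)
        also have "\<dots> < e"
          using n0[OF that] pos by (simp add: less_divide_eq)
        finally show ?thesis .
      qed
      then show "\<exists>n0. \<forall>m\<ge>n0. \<forall>n\<ge>n0. norm (f m x - f n x) < e" by blast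
    qed
    then show ?thesis by (rule Cauchy_convergent)
  next
    case False
    then have "f n x = 0" for n using f by (simp add: Lip0_iff)
    then show ?thesis by (simp add: convergent_const)
  qed
  define l where "l x = lim (\<lambda>n. f n x)" for x
  have l: "(\<lambda>n. f n x) \<longlonglongrightarrow> l x" for x
    using conv[of x] by (simp add: l_def convergent_LIMSEQ_iff)
  have lim0: "l x = 0" if "\<And>n. f n x = 0" for x
    using that by (simp add: l_def)
  have close: "\<exists>n0. \<forall>n\<ge>n0. \<forall>x \<in> mspace M. \<forall>y \<in> mspace M.
      \<bar>(f n - l) x - (f n - l) y\<bar> \<le> e * mdist M x y" if e: "e > 0" for e
  proof -
    obtain n0 where n0: "\<And>m n. m \<ge> n0 \<Longrightarrow> n \<ge> n0 \<Longrightarrow> lip_norm M (f m - f n) < e"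
      using cauchy e by metis
    have "\<bar>(f n - l) x - (f n - l) y\<bar> \<le> e * mdist M x y"
      if n: "n \<ge> n0" and xy: "x \<in> mspace M" "y \<in> mspace M" for n x y
    proof (rule LIMSEQ_le_const2)
      show "(\<lambda>m. \<bar>(f n x - f m x) - (f n y - f m y)\<bar>) \<longlonglongrightarrow> \<bar>(f n - l) x - (f n - l) y\<bar>"
        unfolding fun_diff_def by (intro tendsto_intros l)
      have "\<bar>(f n x - f m x) - (f n y - f m y)\<bar> \<le> e * mdist M x y" if "m \<ge> n0" for m
      proof -
        have "\<bar>(f n x - f m x) - (f n y - f m y)\<bar> \<le> lip_norm M (f n - f m) * mdist M x y"
          using lip_norm_bound[OF diff xy, of n m] by simp
        also have "\<dots> \<le> e * mdist M x y"
          using n0[OF n that] by (intro mult_right_mono) auto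
        finally show ?thesis .
      qed
      then show "\<exists>n0. \<forall>m\<ge>n0. \<bar>(f n x - f m x) - (f n y - f m y)\<bar> \<le> e * mdist M x y"
        by blast
    qed
    then show ?thesis by blast
  qed
  obtain n1 where n1: "\<forall>x \<in> mspace M. \<forall>y \<in> mspace M.
      \<bar>(f n1 - l) x - (f n1 - l) y\<bar> \<le> 1 * mdist M x y"
    using close[of 1] by fastforce
  have "f n1 - l \<in> Lip0 M b"
    using n1 f lim0 unfolding Lip0_iff by (auto intro!: exI[of _ 1])
  then have "f n1 - (f n1 - l) \<in> Lip0 M b"
    by (rule subspace_diff[OF subspace_Lip0 f])
  then have lL: "l \<in> Lip0 M b" by simp
  have fl: "f n - l \<in> Lip0 M b" for n
    by (rule subspace_diff[OF subspace_Lip0 f lL])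
  have "(\<lambda>n. lip_norm M (f n - l)) \<longlonglongrightarrow> 0"
  proof (rule LIMSEQ_I)
    fix e :: real assume e: "e > 0"
    obtain n0 where n0: "\<forall>n\<ge>n0. \<forall>x \<in> mspace M. \<forall>y \<in> mspace M.
        \<bar>(f n - l) x - (f n - l) y\<bar> \<le> e / 2 * mdist M x y"
      using close[of "e / 2"] e by auto
    have "norm (lip_norm M (f n - l) - 0) < e" if "n \<ge> n0" for n
    proof -
      have "lip_norm M (f n - l) \<le> e / 2"
        using n0 that e by (intro lip_norm_le) auto
      then show ?thesis using lip_norm_nonneg[OF fl[of n]] e by simp
    qed
    then show "\<exists>n0. \<forall>n\<ge>n0. norm (lip_norm M (f n - l) - 0) < e" by blast
  qed
  then show "\<exists>l\<in>Lip0 M b. (\<lambda>n. lip_norm M (f n - l)) \<longlonglongrightarrow> 0"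
    using lL by blast
qed

end

theory Submission
  imports Defs
begin

text \<open>
  The strongly extreme point is a 1-Lipschitz function \<open>f\<close> that is isometric along enough edges.
  If \<open>\<bar>f u - f v\<bar> = d(u,v)\<close> and both \<open>f + g\<close> and \<open>f - g\<close> have norm at most \<open>1 + e\<close>, then
  \<open>\<bar>g u - g v\<bar> \<le> e d(u,v)\<close>.  So if any two points \<open>x\<close> and \<open>y\<close> are joined by a chain of such
  \<^emph>\<open>tight\<close> edges, of total length at most \<open>8 d(x,y)\<close> (up to a limit), then \<open>g\<close> has norm at most
  \<open>8 e\<close>.

  The edges come from scales.  In an ultrametric space the balls \<open>{y. d(x,y) < 2\<^sup>n}\<close>, for an integer
  \<open>n\<close>, partition the space.  Choose in each ball a representative, coherently: the representative
  of a ball also represents every smaller ball that contains it, and the base point \<open>b\<close> represents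
  all balls around it (\<open>nested_nets_exist\<close>).  With \<open>\<pi>\<^sub>n x\<close> the representative of the ball of \<open>x\<close> at
  scale \<open>n\<close>, the edges \<open>\<pi>\<^sub>n x, \<pi>\<^sub>n\<^sub>+\<^sub>1 x\<close> make up a tree with root \<open>b\<close>.  Their lengths are less than
  \<open>2\<^sup>n\<^sup>+\<^sup>1\<close>, so chains have geometrically decreasing lengths as one descends from the ball that \<open>x\<close>
  and \<open>y\<close> share, and they are short in the sense above.

  It remains to define \<open>f\<close> along the tree: it changes by exactly the length of each edge, and the
  sign of the change alternates with the depth.  The change is upwards at the root; below a vertex
  that was reached upwards it is downwards, and so on.  Alternation is what keeps \<open>f\<close> 1-Lipschitz.
  The value at a descendant \<open>x\<close> of \<open>p\<close> deviates from \<open>f p\<close> only in the direction assigned to \<open>p\<close>, by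
  at most \<open>d(x,p)\<close>, because the next edge below turns back and is shorter
  (\<open>zigzag_at_offset\<close>).  Two points whose distances to their last common ancestor \<open>q\<close> differ are
  at mutual distance equal to the larger of these, so their values, on the same side of \<open>f q\<close>,
  are close enough; if the distances are equal, both values have nearly the maximal deviation from
  \<open>f q\<close>, and the error is at most the scale that separates the two points
  (\<open>zigzag_at_lipschitz\<close>).  On all of \<open>M\<close> the function is the limit of its values at \<open>\<pi>\<^sub>n x\<close> for
  \<open>n \<rightarrow> -\<infinity>\<close>.

  Finally, in any normed space a strongly extreme point refutes local almost squareness, since
  witnesses for \<open>\<epsilon> \<rightarrow> 0\<close> would be a sequence of unit vectors that should tend to \<open>0\<close>.
\<close>

section \<open>Strongly extreme points and local almost squareness\<close>

text \<open>A linear modulus of strong extremality; for the function constructed below it holds with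
  \<open>C = 8\<close>.\<close>

lemma strongly_extreme_pointI:
  assumes "f \<in> unit_sphere X N"
    and nonneg: "\<And>y. y \<in> X \<Longrightarrow> 0 \<le> N y"
    and bound: "\<And>y e. y \<in> X \<Longrightarrow> 0 \<le> e \<Longrightarrow> N (f + y) \<le> 1 + e \<Longrightarrow> N (f - y) \<le> 1 + e \<Longrightarrow> N y \<le> C * e"
  shows "strongly_extreme_point X N f"
  unfolding strongly_extreme_point_def
proof (intro conjI allI impI)
  fix y :: "nat \<Rightarrow> 'a"
  assume "range y \<subseteq> X" and plus: "(\<lambda>n. N (f + y n)) \<longlonglongrightarrow> 1" and minus: "(\<lambda>n. N (f - y n)) \<longlonglongrightarrow> 1"
  then have y: "y n \<in> X" for n by auto
  define e where "e n = \<bar>N (f + y n) - 1\<bar> + \<bar>N (f - y n) - 1\<bar>" for n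
  have "e \<longlonglongrightarrow> \<bar>1 - 1\<bar> + \<bar>1 - 1\<bar>"
    unfolding e_def by (intro tendsto_intros plus minus)
  then have "(\<lambda>n. C * e n) \<longlonglongrightarrow> 0"
    using tendsto_mult_left[of e 0 sequentially C] by simp
  moreover have "N (y n) \<le> C * e n" for n
    by (rule bound[OF y]) (auto simp: e_def)
  ultimately show "(\<lambda>n. N (y n)) \<longlonglongrightarrow> 0"
    using nonneg[OF y] by (intro Lim_null_comparison[of "\<lambda>n. N (y n)" "\<lambda>n. C * e n"]) auto
qed (fact assms(1))

text \<open>Vectors that witness local almost squareness at \<open>f\<close> for \<open>\<epsilon> = 1/(n+1)\<close> are exactly what strong
  extremality forbids, once \<open>N (f \<plusminus> y\<^sub>n)\<close> is bounded from below: this holds because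
  \<open>2 = N ((f + y\<^sub>n) + (f - y\<^sub>n))\<close>.\<close>

lemma strongly_extreme_point_imp_not_locally_almost_square:
  assumes normed: "normed_space_on X N" and extreme: "strongly_extreme_point X N f"
  shows "\<not> locally_almost_square X N"
proof
  assume lasq: "locally_almost_square X N"
  have f: "f \<in> X" "N f = 1"
    using extreme by (auto simp: strongly_extreme_point_def unit_sphere_def)
  have sub: "subspace X" and scale: "\<And>x c. x \<in> X \<Longrightarrow> N (c *\<^sub>R x) = \<bar>c\<bar> * N x"
    and add: "\<And>x y. x \<in> X \<Longrightarrow> y \<in> X \<Longrightarrow> N (x + y) \<le> N x + N y"
    using normed by (auto simp: normed_space_on_def)
  have "\<exists>y\<in>X. N y = 1 \<and> N (f + y) \<le> 1 + e \<and> N (f - y) \<le> 1 + e" if "e > 0" for e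
    using lasq f that unfolding locally_almost_square_def unit_sphere_def by blast
  then have "\<exists>y\<in>X. N y = 1 \<and> N (f + y) \<le> 1 + inverse (real (Suc n)) \<and>
      N (f - y) \<le> 1 + inverse (real (Suc n))" for n
    by (meson inverse_positive_iff_positive of_nat_0_less_iff zero_less_Suc)
  then obtain y where y: "\<And>n. y n \<in> X" "\<And>n. N (y n) = 1"
    and up: "\<And>n. N (f + y n) \<le> 1 + inverse (real (Suc n))" "\<And>n. N (f - y n) \<le> 1 + inverse (real (Suc n))"
    by metis
  have "2 \<le> N (f + y n) + N (f - y n)" for n
  proof -
    have "(f + y n) + (f - y n) = 2 *\<^sub>R f" by (simp add: scaleR_2)
    then show ?thesis
      using add[of "f + y n" "f - y n"] scale[OF f(1), of 2] f y(1)[of n]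
        subspace_add[OF sub] subspace_diff[OF sub] by simp
  qed
  then have low: "1 - inverse (real (Suc n)) \<le> N (f + y n)" "1 - inverse (real (Suc n)) \<le> N (f - y n)" for n
    using up[of n] by (smt (verit))+
  have lim: "(\<lambda>n. 1 + inverse (real (Suc n))) \<longlonglongrightarrow> 1" "(\<lambda>n. 1 - inverse (real (Suc n))) \<longlonglongrightarrow> 1"
    using LIMSEQ_inverse_real_of_nat_add[of 1] tendsto_diff[OF tendsto_const LIMSEQ_inverse_real_of_nat, of "1::real"]
    by simp_all
  have "(\<lambda>n. N (f + y n)) \<longlonglongrightarrow> 1" "(\<lambda>n. N (f - y n)) \<longlonglongrightarrow> 1"
    by (rule tendsto_sandwich[OF _ _ lim(2) lim(1)]; simp add: low up del: of_nat_Suc)+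
  then have "(\<lambda>n. N (y n)) \<longlonglongrightarrow> 0"
    using extreme y(1) unfolding strongly_extreme_point_def by blast
  then show False by (simp add: y(2) LIMSEQ_const_iff)
qed

section \<open>Nested nets of an ultrametric space\<close>

text \<open>The representative of a set is its first element for a well-order in which \<open>b\<close> has been
  made the least element: the first element of \<open>A\<close> stays first in every subset to which it
  belongs.\<close>

lemma coherent_choice_exists:
  fixes b :: 'a
  shows "\<exists>c :: 'a set \<Rightarrow> 'a.
    (\<forall>A. A \<noteq> {} \<longrightarrow> c A \<in> A) \<and> (\<forall>A B. B \<subseteq> A \<longrightarrow> c A \<in> B \<longrightarrow> c B = c A) \<and>
    (\<forall>A. b \<in> A \<longrightarrow> c A = b)"
proof -
  obtain r :: "'a rel" where "well_order_on UNIV r"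
    using well_order_on by blast
  then have wf: "wf (r - Id)" and tot: "total r" and anti: "antisym r"
    by (auto simp: well_order_on_def linear_order_on_def partial_order_on_def)
  define first where "first A z \<longleftrightarrow> z \<in> A \<and> (\<forall>y\<in>A. y \<noteq> z \<longrightarrow> (z, y) \<in> r)" for A z
  have ex: "\<exists>z. first A z" if ne: "A \<noteq> {}" for A
  proof -
    obtain z where z: "z \<in> A" "\<And>y. (y, z) \<in> r - Id \<Longrightarrow> y \<notin> A"
      using wfE_min'[OF wf ne] by blast
    then have "first A z"
      using tot unfolding first_def total_on_def by blast
    then show ?thesis by blast
  qed
  have unique: "y = z" if "first A y" "first A z" for A y z
    using that anti unfolding first_def antisym_def by metis
  define c where "c A = (if b \<in> A then b else SOME z. first A z)" for A
  have first_c: "first A (c A)" if "A \<noteq> {}" "b \<notin> A" for A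
    using someI_ex[OF ex[OF that(1)]] that by (simp add: c_def)
  have "c A \<in> A" if "A \<noteq> {}" for A
    using first_c[OF that] by (cases "b \<in> A") (auto simp: c_def first_def)
  moreover have "c B = c A" if "B \<subseteq> A" "c A \<in> B" for A B
  proof (cases "b \<in> A")
    case True
    then show ?thesis using that by (simp add: c_def)
  next
    case False
    have "first A (c A)" using first_c[of A] that False by auto
    then have "first B (c A)" using that by (auto simp: first_def)
    moreover have "first B (c B)" using first_c[of B] that False by auto
    ultimately show ?thesis using unique by blast
  qed
  moreover have "c A = b" if "b \<in> A" for A
    using that by (simp add: c_def)
  ultimately show ?thesis by blast
qed

lemma powi_scale_exists:
  fixes r :: real
  assumes "r > 0"
  obtains k :: int where "2 powi k \<le> r" "r < 2 powi (k + 1)"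
proof
  define k where "k = \<lfloor>log 2 r\<rfloor>"
  have powr: "2 powi m = 2 powr real_of_int m" for m :: int
    by (simp add: powr_real_of_int')
  have "real_of_int k \<le> log 2 r" "log 2 r < real_of_int (k + 1)"
    by (simp_all add: k_def)
  then show "2 powi k \<le> r" "r < 2 powi (k + 1)"
    using assms unfolding powr by (simp_all add: le_log_iff log_less_iff)
qed

text \<open>\<open>\<pi> n x\<close> is the chosen representative of the ball \<open>{y. d(x,y) < 2\<^sup>n}\<close>.  Since the representatives
  at a coarse scale remain representatives at finer ones, distinct points of the net at scale \<open>n\<close>
  are at distance at least \<open>2\<^sup>n\<close>.\<close>

locale nested_nets =
  fixes M :: "'a metric" and b :: 'a and \<pi> :: "int \<Rightarrow> 'a \<Rightarrow> 'a"
  assumes ultrametric: "ultrametric_space M"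
    and base_in: "b \<in> mspace M"
    and net_in: "x \<in> mspace M \<Longrightarrow> \<pi> n x \<in> mspace M"
    and net_close: "x \<in> mspace M \<Longrightarrow> mdist M x (\<pi> n x) < 2 powi n"
    and net_eqI: "x \<in> mspace M \<Longrightarrow> y \<in> mspace M \<Longrightarrow> mdist M x y < 2 powi n \<Longrightarrow> \<pi> n x = \<pi> n y"
    and net_nested: "x \<in> mspace M \<Longrightarrow> m \<le> n \<Longrightarrow> \<pi> m (\<pi> n x) = \<pi> n x"
    and net_base: "\<pi> n b = b"

text \<open>Apply a coherent choice to the balls; two balls of the same radius with a common point are
  equal, so the representative depends only on the ball.\<close>

lemma nested_nets_exist:
  assumes ultra: "ultrametric_space M" and b: "b \<in> mspace M"
  shows "\<exists>\<pi>. nested_nets M b \<pi>"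
proof -
  obtain c where c_in: "\<And>A. A \<noteq> {} \<Longrightarrow> c A \<in> A"
    and c_sub: "\<And>A B. B \<subseteq> A \<Longrightarrow> c A \<in> B \<Longrightarrow> c B = c A"
    and c_base: "\<And>A. b \<in> A \<Longrightarrow> c A = b"
    using coherent_choice_exists[of b] by metis
  define C where "C n x = {y \<in> mspace M. mdist M x y < 2 powi n}" for n :: int and x
  have tri: "mdist M x y \<le> max (mdist M x z) (mdist M z y)"
    if "x \<in> mspace M" "y \<in> mspace M" "z \<in> mspace M" for x y z
    using ultra that unfolding ultrametric_space_def by blast
  have self: "x \<in> C n x" if "x \<in> mspace M" for n x
  proof -
    have "mdist M x x = 0" using that by simp
    also have "(0::real) < 2 powi n" by simp
    finally show ?thesis using that by (simp add: C_def)
  qed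
  have cC: "c (C n x) \<in> C n x" if "x \<in> mspace M" for n x
    using c_in self[OF that] by blast
  have C_le: "C n y \<subseteq> C n x" if "x \<in> mspace M" "y \<in> mspace M" "mdist M x y < 2 powi n" for n x y
  proof
    fix z assume "z \<in> C n y"
    then show "z \<in> C n x"
      using tri[of x z y] that by (auto simp: C_def)
  qed
  have C_eq: "C n x = C n y" if "x \<in> mspace M" "y \<in> mspace M" "mdist M x y < 2 powi n" for n x y
    using C_le[of x y n] C_le[of y x n] that by (simp add: mdist_commute)
  have C_mono: "C m x \<subseteq> C n x" if "m \<le> n" for m n x
    using power_int_increasing[OF that, of "2::real"] by (auto simp: C_def)
  have "nested_nets M b (\<lambda>n x. c (C n x))"
  proof
    fix x n assume x: "x \<in> mspace M"
    show "c (C n x) \<in> mspace M" "mdist M x (c (C n x)) < 2 powi n"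
      using cC[OF x, of n] by (auto simp: C_def)
  next
    fix x y n assume "x \<in> mspace M" "y \<in> mspace M" "mdist M x y < 2 powi n"
    then show "c (C n x) = c (C n y)" using C_eq by metis
  next
    fix x and m n :: int assume x: "x \<in> mspace M" and mn: "m \<le> n"
    have p: "c (C n x) \<in> mspace M" "mdist M x (c (C n x)) < 2 powi n"
      using cC[OF x, of n] by (auto simp: C_def)
    have "C m (c (C n x)) \<subseteq> C n x"
      using C_mono[OF mn, of "c (C n x)"] C_eq[OF x p] by simp
    then show "c (C m (c (C n x))) = c (C n x)"
      by (rule c_sub) (rule self[OF p(1)])
  next
    show "c (C n b) = b" for n using c_base self[OF b] by blast
  qed (use ultra b in auto)
  then show ?thesis by blast
qed

context nested_nets
begin

lemma tri:
  assumes "x \<in> mspace M" "y \<in> mspace M" "z \<in> mspace M"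
  shows "mdist M x y \<le> max (mdist M x z) (mdist M z y)"
  using ultrametric assms unfolding ultrametric_space_def by blast

lemma isosceles:
  assumes "x \<in> mspace M" "y \<in> mspace M" "z \<in> mspace M" "mdist M x z < mdist M y z"
  shows "mdist M x y = mdist M y z"
  using tri[of x y z] tri[of y z x] assms by (simp add: mdist_commute)

lemma net_net:
  assumes "x \<in> mspace M" "m \<le> n"
  shows "\<pi> n (\<pi> m x) = \<pi> n x"
proof -
  have "mdist M x (\<pi> m x) < 2 powi n"
    using net_close[OF assms(1), of m] power_int_increasing[OF assms(2), of "2::real"] by simp
  then show ?thesis using net_eqI[of x "\<pi> m x" n] net_in assms by simp
qed

lemma net_dist_less:
  assumes "x \<in> mspace M" "m \<le> n"
  shows "mdist M (\<pi> m x) (\<pi> n x) < 2 powi n"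
  using net_close[OF net_in[OF assms(1), of m], of n] net_net[OF assms] by simp

lemma net_separated:
  assumes "x \<in> mspace M" "y \<in> mspace M" "\<pi> k x \<noteq> \<pi> k y"
  shows "2 powi k \<le> mdist M x y"
  using net_eqI assms by (meson not_le)

lemma net_step_ge:
  assumes "x \<in> mspace M" "\<pi> k x \<noteq> \<pi> (k + 1) x"
  shows "2 powi k \<le> mdist M (\<pi> k x) (\<pi> (k + 1) x)"
  by (rule net_separated) (use assms net_in net_nested in auto)

text \<open>This makes the tree of edges rooted at \<open>b\<close>: every point has only finitely many ancestors
  above a given scale.\<close>

lemma net_eq_base:
  assumes "x \<in> mspace M"
  obtains N where "\<And>n. N \<le> n \<Longrightarrow> \<pi> n x = b"
proof -
  obtain N :: nat where N: "mdist M x b < 2 ^ N"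
    using real_arch_pow[of "2::real"] by auto
  have "\<pi> n x = b" if "int N \<le> n" for n
  proof -
    have "mdist M x b < 2 powi n"
      using N power_int_increasing[OF that, of "2::real"] by simp
    then show ?thesis using net_eqI[OF assms base_in] net_base by simp
  qed
  then show ?thesis using that by blast
qed

section \<open>The zigzag function\<close>

definition jumps :: "int \<Rightarrow> 'a \<Rightarrow> int set" where
  "jumps k x = {m. k \<le> m \<and> \<pi> m x \<noteq> \<pi> (m + 1) x}"

text \<open>The sign of the change of the zigzag function along the edges that lead down from \<open>\<pi>\<^sub>k x\<close>; it is
  the parity of the depth of \<open>\<pi>\<^sub>k x\<close> in the tree.\<close>

definition orient :: "int \<Rightarrow> 'a \<Rightarrow> real" where
  "orient k x = (- 1) ^ card (jumps k x)"

text \<open>The value of the zigzag function at the tree vertex \<open>\<pi>\<^sub>k x\<close>, summed along the path from the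
  root.  Writing it as a function of \<open>k\<close> and \<open>x\<close>, rather than of the vertex, avoids recursion over
  the tree: everything below follows from the one-step equations for \<open>orient\<close> and \<open>zigzag_at\<close>.\<close>

definition zigzag_at :: "int \<Rightarrow> 'a \<Rightarrow> real" where
  "zigzag_at k x = (\<Sum>m\<in>jumps k x. orient (m + 1) x * mdist M (\<pi> m x) (\<pi> (m + 1) x))"

lemma finite_jumps:
  assumes "x \<in> mspace M"
  shows "finite (jumps k x)"
proof -
  obtain N where N: "\<And>n. N \<le> n \<Longrightarrow> \<pi> n x = b" using net_eq_base[OF assms] by blast
  have "jumps k x \<subseteq> {k..<N}"
  proof
    fix m assume m: "m \<in> jumps k x"
    have "m < N"
    proof (rule ccontr)
      assume "\<not> m < N"
      then have "\<pi> m x = b" "\<pi> (m + 1) x = b" using N by auto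
      then show False using m by (simp add: jumps_def)
    qed
    then show "m \<in> {k..<N}" using m by (simp add: jumps_def)
  qed
  then show ?thesis by (rule finite_subset) simp
qed

lemma jumps_rec:
  "jumps k x = (if \<pi> k x = \<pi> (k + 1) x then jumps (k + 1) x else insert k (jumps (k + 1) x))"
proof -
  have "k \<le> m \<longleftrightarrow> m = k \<or> k + 1 \<le> m" for m by auto
  then show ?thesis unfolding jumps_def by auto
qed

lemma not_in_jumps_Suc: "k \<notin> jumps (k + 1) x"
  by (simp add: jumps_def)

lemma orient_rec:
  assumes "x \<in> mspace M"
  shows "orient k x = (if \<pi> k x = \<pi> (k + 1) x then orient (k + 1) x else - orient (k + 1) x)"
  unfolding orient_def
  by (subst jumps_rec) (simp add: finite_jumps[OF assms] not_in_jumps_Suc)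

lemma zigzag_at_rec:
  assumes "x \<in> mspace M"
  shows "zigzag_at k x =
    zigzag_at (k + 1) x + orient (k + 1) x * mdist M (\<pi> k x) (\<pi> (k + 1) x)"
  unfolding zigzag_at_def
  by (subst jumps_rec)
    (simp add: finite_jumps[OF assms] not_in_jumps_Suc net_in[OF assms])

lemma orient_sq [simp]: "orient k x * orient k x = 1"
  by (simp add: orient_def flip: power_mult_distrib)

lemma abs_orient [simp]: "\<bar>orient k x\<bar> = 1"
  by (simp add: orient_def)

text \<open>Path, orientation and value depend only on the vertex \<open>\<pi>\<^sub>k x\<close>, so they may be compared along
  two branches that meet there.\<close>

lemma jumps_cong:
  assumes "x \<in> mspace M" "y \<in> mspace M" "\<pi> k x = \<pi> k y"
  shows "m \<ge> k \<Longrightarrow> \<pi> m x = \<pi> m y" and "jumps k x = jumps k y"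
proof -
  show eq: "\<pi> m x = \<pi> m y" if "m \<ge> k" for m
    using net_net[OF assms(1) that] net_net[OF assms(2) that] assms(3) by simp
  show "jumps k x = jumps k y"
    unfolding jumps_def using eq by fastforce
qed

lemma orient_cong:
  assumes "x \<in> mspace M" "y \<in> mspace M" "\<pi> k x = \<pi> k y"
  shows "orient k x = orient k y"
  using jumps_cong(2)[OF assms] by (simp add: orient_def)

lemma zigzag_at_cong:
  assumes "x \<in> mspace M" "y \<in> mspace M" "\<pi> k x = \<pi> k y"
  shows "zigzag_at k x = zigzag_at k y"
  unfolding zigzag_at_def
proof (rule sum.cong[OF jumps_cong(2)[OF assms]])
  fix m assume "m \<in> jumps k y"
  then have "k \<le> m" by (simp add: jumps_def)
  then have "\<pi> m x = \<pi> m y" "\<pi> (m + 1) x = \<pi> (m + 1) y"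
    using jumps_cong(1)[OF assms] by auto
  moreover have "orient (m + 1) x = orient (m + 1) y"
    by (rule orient_cong) (use assms calculation in auto)
  ultimately show "orient (m + 1) x * mdist M (\<pi> m x) (\<pi> (m + 1) x) =
      orient (m + 1) y * mdist M (\<pi> m y) (\<pi> (m + 1) y)" by simp
qed

text \<open>The deviation from the parent, in the parent's direction, is the length of the edge minus the
  deviation from the child in the child's own direction, because the two directions are opposite.\<close>

lemma zigzag_at_offset_flip:
  assumes x: "x \<in> mspace M" and moves: "\<pi> k x \<noteq> \<pi> (k + 1) x"
  shows "orient (k + 1) x * (zigzag_at j x - zigzag_at (k + 1) x) =
    mdist M (\<pi> k x) (\<pi> (k + 1) x) - orient k x * (zigzag_at j x - zigzag_at k x)"
proof -
  have "orient (k + 1) x * (zigzag_at j x - zigzag_at (k + 1) x) =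
      orient (k + 1) x * (zigzag_at j x - zigzag_at k x) +
      (orient (k + 1) x * orient (k + 1) x) * mdist M (\<pi> k x) (\<pi> (k + 1) x)"
    using zigzag_at_rec[OF x, of k] by (simp add: algebra_simps del: orient_sq)
  moreover have "orient (k + 1) x = - orient k x"
    using orient_rec[OF x, of k] moves by simp
  ultimately show ?thesis
    by (simp only: orient_sq) simp
qed

lemma net_dist_moving:
  assumes x: "x \<in> mspace M" and jk: "j \<le> k" and moves: "\<pi> k x \<noteq> \<pi> (k + 1) x"
  shows "mdist M (\<pi> j x) (\<pi> (k + 1) x) = mdist M (\<pi> k x) (\<pi> (k + 1) x)"
  using isosceles[of "\<pi> j x" "\<pi> (k + 1) x" "\<pi> k x"] net_dist_less[OF x jk]
    net_step_ge[OF x moves] net_in[OF x] by (simp add: mdist_commute)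

text \<open>Descendants of \<open>\<pi>\<^sub>k x\<close> have values on one side of the value there.  Going up one edge keeps this
  property: the edge has length at least \<open>2\<^sup>k\<close>, whereas the deviation that is subtracted from it,
  inside the ball of radius \<open>2\<^sup>k\<close>, is smaller.\<close>

lemma zigzag_at_offset:
  assumes x: "x \<in> mspace M" and "j \<le> k"
  shows "0 \<le> orient k x * (zigzag_at j x - zigzag_at k x) \<and>
    orient k x * (zigzag_at j x - zigzag_at k x) \<le> mdist M (\<pi> j x) (\<pi> k x)"
  using \<open>j \<le> k\<close>
proof (induction k rule: int_ge_induct)
  case base
  then show ?case by (simp add: net_in[OF x])
next
  case (step k)
  show ?case
  proof (cases "\<pi> k x = \<pi> (k + 1) x")
    case True
    then have "zigzag_at k x = zigzag_at (k + 1) x" "orient k x = orient (k + 1) x"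
      using zigzag_at_rec[OF x, of k] orient_rec[OF x, of k] net_in[OF x] by simp_all
    then show ?thesis using step.IH True by simp
  next
    case False
    show ?thesis
      using step.IH net_dist_less[OF x step.hyps] net_step_ge[OF x False]
        net_dist_moving[OF x step.hyps False] zigzag_at_offset_flip[OF x False, of j]
      by linarith
  qed
qed

text \<open>The deviations \<open>u\<close> and \<open>v\<close> from the value at the last common ancestor \<open>q\<close> are compared.  They lie
  between \<open>0\<close> and the distances to \<open>q\<close>, which suffices when these distances differ, for then the
  larger one is the distance between the two points.  When they are equal, both branches leave
  \<open>q\<close> by an edge of that length, and each deviation falls short of it by at most \<open>2\<^sup>k\<close>, the scale
  at which the branches are already separated.\<close>

lemma zigzag_at_lipschitz:
  assumes x: "x \<in> mspace M" and y: "y \<in> mspace M"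
  shows "\<bar>zigzag_at j x - zigzag_at j y\<bar> \<le> mdist M (\<pi> j x) (\<pi> j y)"
proof (cases "\<pi> j x = \<pi> j y")
  case True
  then show ?thesis using zigzag_at_cong[OF x y True] by (simp add: net_in[OF y])
next
  case False
  \<comment> \<open>Both branches reach the root, so there is a scale at which they meet for the first time.\<close>
  have "\<exists>k\<ge>j. \<pi> k x \<noteq> \<pi> k y \<and> \<pi> (k + 1) x = \<pi> (k + 1) y"
  proof (rule ccontr)
    assume no: "\<not> ?thesis"
    have neq: "\<pi> k x \<noteq> \<pi> k y" if "j \<le> k" for k
      using that by (induction k rule: int_ge_induct) (use False no in auto)
    obtain N where "\<And>n. N \<le> n \<Longrightarrow> \<pi> n x = b" using net_eq_base[OF x] by blast
    moreover obtain N' where "\<And>n. N' \<le> n \<Longrightarrow> \<pi> n y = b" using net_eq_base[OF y] by blast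
    ultimately show False using neq[of "max j (max N N')"] by simp
  qed
  then obtain k where jk: "j \<le> k" and apart: "\<pi> k x \<noteq> \<pi> k y"
    and join: "\<pi> (k + 1) x = \<pi> (k + 1) y" by blast
  define q where "q = \<pi> (k + 1) x"
  define s where "s = orient (k + 1) x"
  define z where "z = zigzag_at (k + 1) x"
  have qy: "\<pi> (k + 1) y = q" and sy: "orient (k + 1) y = s" and zy: "zigzag_at (k + 1) y = z"
    using join orient_cong[OF x y join] zigzag_at_cong[OF x y join] by (simp_all add: q_def s_def z_def)
  note ins = net_in[OF x, of j] net_in[OF y, of j] net_in[OF x, of "k + 1", folded q_def]
  define u where "u = s * (zigzag_at j x - z)"
  define v where "v = s * (zigzag_at j y - z)"
  have u: "0 \<le> u" "u \<le> mdist M (\<pi> j x) q"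
    using zigzag_at_offset[OF x, of j "k + 1"] jk unfolding q_def s_def z_def u_def by auto
  have v: "0 \<le> v" "v \<le> mdist M (\<pi> j y) q"
    using zigzag_at_offset[OF y, of j "k + 1"] jk unfolding qy sy zy v_def by auto
  have "\<bar>zigzag_at j x - zigzag_at j y\<bar> = \<bar>s * (zigzag_at j x - zigzag_at j y)\<bar>"
    by (simp add: abs_mult s_def)
  also have "\<dots> = \<bar>u - v\<bar>"
    by (simp add: u_def v_def right_diff_distrib)
  also have "\<dots> \<le> mdist M (\<pi> j x) (\<pi> j y)"
  proof (cases "mdist M (\<pi> j x) q = mdist M (\<pi> j y) q")
    case False
    then have "mdist M (\<pi> j x) (\<pi> j y) = max (mdist M (\<pi> j x) q) (mdist M (\<pi> j y) q)"
      using isosceles[of "\<pi> j x" "\<pi> j y" q] isosceles[of "\<pi> j y" "\<pi> j x" q] ins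
      by (auto simp: mdist_commute max_def)
    then show ?thesis using u v by linarith
  next
    case True
    have piq: "\<pi> k q = q" using net_nested[OF x, of k "k + 1"] by (simp add: q_def)
    have join_k: "\<pi> k x = q" if "mdist M (\<pi> j x) q < 2 powi k"
      using net_eqI[OF _ _ that] ins net_net[OF x jk] piq by simp
    have join_k': "\<pi> k y = q" if "mdist M (\<pi> j y) q < 2 powi k"
      using net_eqI[OF _ _ that] ins net_net[OF y jk] piq by simp
    have far: "2 powi k \<le> mdist M (\<pi> j x) (\<pi> j y)"
      by (rule net_separated) (use ins apart net_net[OF x jk] net_net[OF y jk] in auto)
    have big: "2 powi k \<le> mdist M (\<pi> j x) q"
      using join_k join_k' apart True by fastforce
    have nx: "\<pi> k x \<noteq> \<pi> (k + 1) x"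
      using big net_dist_less[OF x jk] by (auto simp: q_def)
    have ny: "\<pi> k y \<noteq> \<pi> (k + 1) y"
      using big net_dist_less[OF y jk] True qy by auto
    have "mdist M (\<pi> j x) q - 2 powi k \<le> u"
      using zigzag_at_offset[OF x jk] zigzag_at_offset_flip[OF x nx, of j] net_dist_less[OF x jk]
        net_dist_moving[OF x jk nx] unfolding q_def s_def z_def u_def by linarith
    moreover have "mdist M (\<pi> j y) q - 2 powi k \<le> v"
      using zigzag_at_offset[OF y jk] zigzag_at_offset_flip[OF y ny, of j] net_dist_less[OF y jk]
        net_dist_moving[OF y jk ny] unfolding qy sy zy v_def by linarith
    ultimately show ?thesis using u v far True by linarith
  qed
  finally show ?thesis .
qed

text \<open>The points \<open>\<pi>\<^sub>n x\<close> need not reach \<open>x\<close>, only converge to it, hence the limit.\<close>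

definition zigzag :: "'a \<Rightarrow> real" where
  "zigzag x = (if x \<in> mspace M then lim (\<lambda>n. zigzag_at (- int n) x) else 0)"

lemma tendsto_half_powers: "(\<lambda>n. 2 powi (- int n) :: real) \<longlonglongrightarrow> 0"
  using LIMSEQ_realpow_zero[of "1/2::real"] by (simp add: power_int_minus power_divide inverse_eq_divide)

lemma zigzag_at_tendsto:
  assumes x: "x \<in> mspace M"
  shows "(\<lambda>n. zigzag_at (- int n) x) \<longlonglongrightarrow> zigzag x"
proof -
  have close: "\<bar>zigzag_at j x - zigzag_at k x\<bar> < 2 powi k" if "j \<le> k" for j k
  proof -
    have "\<bar>orient k x * (zigzag_at j x - zigzag_at k x)\<bar> < 2 powi k"
      using zigzag_at_offset[OF x that] net_dist_less[OF x that] by linarith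
    then show ?thesis by (simp add: abs_mult)
  qed
  have "Cauchy (\<lambda>n. zigzag_at (- int n) x)"
  proof (rule metric_CauchyI)
    fix e :: real assume "0 < e"
    then obtain N where N: "2 powi (- int N) < e / 2"
      using order_tendstoD(2)[OF tendsto_half_powers, of "e / 2"]
      by (auto simp: eventually_sequentially)
    have "dist (zigzag_at (- int m) x) (zigzag_at (- int n) x) < e" if "N \<le> m" "N \<le> n" for m n
      using close[of "- int m" "- int N"] close[of "- int n" "- int N"] that N
      by (simp add: dist_real_def)
    then show "\<exists>N. \<forall>m\<ge>N. \<forall>n\<ge>N. dist (zigzag_at (- int m) x) (zigzag_at (- int n) x) < e" by blast
  qed
  then have "convergent (\<lambda>n. zigzag_at (- int n) x)" by (rule Cauchy_convergent)
  then show ?thesis using x by (simp add: zigzag_def convergent_LIMSEQ_iff)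
qed

lemma zigzag_net:
  assumes x: "x \<in> mspace M"
  shows "zigzag (\<pi> k x) = zigzag_at k x"
proof -
  have p: "\<pi> k x \<in> mspace M" using net_in[OF x] .
  have stable: "zigzag_at j (\<pi> k x) = zigzag_at k x" if "j \<le> k" for j
  proof -
    have fixed: "\<pi> j (\<pi> k x) = \<pi> k (\<pi> k x)"
      using net_nested[OF x] that by simp
    have "mdist M (\<pi> j (\<pi> k x)) (\<pi> k (\<pi> k x)) = 0"
      using fixed net_in[OF p, of k] by simp
    then have "orient k (\<pi> k x) * (zigzag_at j (\<pi> k x) - zigzag_at k (\<pi> k x)) = 0"
      using zigzag_at_offset[OF p that] by linarith
    then have "zigzag_at j (\<pi> k x) = zigzag_at k (\<pi> k x)"
      by (simp add: orient_def)
    also have "\<dots> = zigzag_at k x"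
      by (rule zigzag_at_cong[OF p x]) (simp add: net_nested[OF x])
    finally show ?thesis .
  qed
  have "\<forall>\<^sub>F n in sequentially. zigzag_at (- int n) (\<pi> k x) = zigzag_at k x"
    unfolding eventually_sequentially by (rule exI[of _ "nat (- k)"]) (auto intro: stable)
  then have "(\<lambda>n. zigzag_at (- int n) (\<pi> k x)) \<longlonglongrightarrow> zigzag_at k x"
    by (rule tendsto_eventually)
  then show ?thesis using zigzag_at_tendsto[OF p] LIMSEQ_unique by blast
qed

text \<open>The reason for the construction: no length is lost along the edges of the tree.\<close>

lemma zigzag_edge_tight:
  assumes x: "x \<in> mspace M"
  shows "\<bar>zigzag (\<pi> k x) - zigzag (\<pi> (k + 1) x)\<bar> = mdist M (\<pi> k x) (\<pi> (k + 1) x)"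
  using zigzag_at_rec[OF x, of k] by (simp add: zigzag_net[OF x] abs_mult)

lemma zigzag_lipschitz:
  assumes x: "x \<in> mspace M" and y: "y \<in> mspace M"
  shows "\<bar>zigzag x - zigzag y\<bar> \<le> mdist M x y"
proof (rule LIMSEQ_le)
  show "(\<lambda>n. \<bar>zigzag_at (- int n) x - zigzag_at (- int n) y\<bar>) \<longlonglongrightarrow> \<bar>zigzag x - zigzag y\<bar>"
    by (intro tendsto_intros zigzag_at_tendsto x y)
  show "(\<lambda>n. mdist M x y + 2 * 2 powi (- int n)) \<longlonglongrightarrow> mdist M x y"
    using tendsto_add[OF tendsto_const tendsto_mult_left[OF tendsto_half_powers, of 2], of "mdist M x y"]
    by simp
  have "\<bar>zigzag_at k x - zigzag_at k y\<bar> \<le> mdist M x y + 2 * 2 powi k" for k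
  proof -
    have "mdist M (\<pi> k x) (\<pi> k y) \<le> mdist M (\<pi> k x) x + (mdist M x y + mdist M y (\<pi> k y))"
      using mdist_triangle[of "\<pi> k x" M x "\<pi> k y"] mdist_triangle[of x M y "\<pi> k y"] x y net_in
      by fastforce
    then show ?thesis
      using zigzag_at_lipschitz[OF x y, of k] net_close[OF x, of k] net_close[OF y, of k]
      by (simp add: mdist_commute)
  qed
  then show "\<exists>N. \<forall>n\<ge>N. \<bar>zigzag_at (- int n) x - zigzag_at (- int n) y\<bar>
      \<le> mdist M x y + 2 * 2 powi (- int n)" by blast
qed

lemma zigzag_base: "zigzag b = 0"
proof -
  have "jumps k b = {}" for k by (simp add: jumps_def net_base)
  then have "zigzag_at k b = 0" for k by (simp add: zigzag_at_def)
  then show ?thesis using zigzag_net[OF base_in, of 0] by (simp add: net_base)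
qed

lemma zigzag_in_Lip0: "zigzag \<in> Lip0 M b"
  using zigzag_lipschitz zigzag_base by (auto simp: Lip0_iff zigzag_def intro!: exI[of _ 1])

text \<open>A space with a second point has a nondegenerate edge, because the branch of a point
  \<open>x \<noteq> b\<close> is away from \<open>b\<close> at scales below \<open>d(x,b)\<close> and ends in \<open>b\<close>.\<close>

lemma lip_norm_zigzag:
  assumes "mspace M \<noteq> {b}"
  shows "lip_norm M zigzag = 1"
proof (rule antisym)
  show "lip_norm M zigzag \<le> 1"
    by (rule lip_norm_le) (use zigzag_lipschitz in auto)
  obtain x where x: "x \<in> mspace M" "x \<noteq> b" using assms base_in by blast
  obtain N where N: "\<And>n. N \<le> n \<Longrightarrow> \<pi> n x = b" using net_eq_base[OF x(1)] by blast
  obtain l where l: "2 powi l \<le> mdist M x b"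
    using powi_scale_exists[of "mdist M x b"] Metric_space.mdist_pos_eq[OF Metric_space_mspace_mdist] x base_in by metis
  have start: "\<pi> l x \<noteq> b"
    using net_close[OF x(1), of l] l by auto
  have "\<exists>k. \<pi> k x \<noteq> \<pi> (k + 1) x"
  proof (rule ccontr)
    assume no: "\<nexists>k. \<pi> k x \<noteq> \<pi> (k + 1) x"
    have "\<pi> k x \<noteq> b" if "l \<le> k" for k
      using that by (induction k rule: int_ge_induct) (use start no in auto)
    then show False using N[of "max l N"] by simp
  qed
  then obtain k where k: "\<pi> k x \<noteq> \<pi> (k + 1) x" by blast
  define D where "D = mdist M (\<pi> k x) (\<pi> (k + 1) x)"
  have "D > 0" using Metric_space.mdist_pos_eq[OF Metric_space_mspace_mdist] net_in[OF x(1)] k unfolding D_def by metis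
  moreover have "D \<le> lip_norm M zigzag * D"
    using lip_norm_bound[OF zigzag_in_Lip0 net_in net_in, OF x(1) x(1), of k "k + 1"]
      zigzag_edge_tight[OF x(1), of k] by (simp add: D_def)
  ultimately show "1 \<le> lip_norm M zigzag" by simp
qed

section \<open>Small perturbations of the zigzag function\<close>

text \<open>On a tight edge one of \<open>f + g\<close> and \<open>f - g\<close> has slope \<open>1\<close> plus the modulus of the slope of
  \<open>g\<close>.\<close>

lemma perturbation_edge:
  assumes g: "g \<in> Lip0 M b" and "0 \<le> e"
    and plus: "lip_norm M (zigzag + g) \<le> 1 + e" and minus: "lip_norm M (zigzag - g) \<le> 1 + e"
    and x: "x \<in> mspace M"
  shows "\<bar>g (\<pi> k x) - g (\<pi> (k + 1) x)\<bar> \<le> e * 2 powi (k + 1)"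
proof -
  define p q where "p = \<pi> k x" and "q = \<pi> (k + 1) x"
  have pq: "p \<in> mspace M" "q \<in> mspace M" using net_in[OF x] by (auto simp: p_def q_def)
  have mem: "zigzag + g \<in> Lip0 M b" "zigzag - g \<in> Lip0 M b"
    using subspace_add[OF subspace_Lip0 zigzag_in_Lip0 g]
      subspace_diff[OF subspace_Lip0 zigzag_in_Lip0 g] by auto
  have "\<bar>(zigzag + g) p - (zigzag + g) q\<bar> \<le> (1 + e) * mdist M p q"
    using lip_norm_bound[OF mem(1) pq] mult_right_mono[OF plus mdist_nonneg[of M p q]] by linarith
  moreover have "\<bar>(zigzag - g) p - (zigzag - g) q\<bar> \<le> (1 + e) * mdist M p q"
    using lip_norm_bound[OF mem(2) pq] mult_right_mono[OF minus mdist_nonneg[of M p q]] by linarith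
  moreover have "\<bar>zigzag p - zigzag q\<bar> = mdist M p q"
    using zigzag_edge_tight[OF x] by (simp add: p_def q_def)
  ultimately have "\<bar>g p - g q\<bar> \<le> e * mdist M p q"
    by (simp add: distrib_right)
  also have "\<dots> \<le> e * 2 powi (k + 1)"
    using net_dist_less[OF x, of k "k + 1"] \<open>0 \<le> e\<close>
    by (intro mult_left_mono) (auto simp: p_def q_def)
  finally show ?thesis by (simp add: p_def q_def)
qed

text \<open>Points with \<open>2\<^sup>k \<le> d(x,y) < 2\<^sup>k\<^sup>+\<^sup>1\<close> share their ancestor at scale \<open>k + 1\<close>.  The edges below it on
  either branch have total length at most \<open>2\<^sup>k\<^sup>+\<^sup>1 + 2\<^sup>k + \<dots> = 2\<^sup>k\<^sup>+\<^sup>2\<close>, which for the two branches together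
  is \<open>8 \<cdot> 2\<^sup>k\<close>.\<close>

lemma lip_norm_perturbation_le:
  assumes g: "g \<in> Lip0 M b" and e: "0 \<le> e"
    and plus: "lip_norm M (zigzag + g) \<le> 1 + e" and minus: "lip_norm M (zigzag - g) \<le> 1 + e"
  shows "lip_norm M g \<le> 8 * e"
proof (rule lip_norm_le)
  have chain: "\<bar>g (\<pi> j x) - g (\<pi> k x)\<bar> \<le> e * (2 powi (k + 1) - 2 powi (j + 1))"
    if x: "x \<in> mspace M" and "j \<le> k" for x j k
    using \<open>j \<le> k\<close>
  proof (induction k rule: int_ge_induct)
    case (step k)
    have "(2::real) powi (k + 1 + 1) = 2 * 2 powi (k + 1)"
      by (subst power_int_add_1) auto
    then show ?case
      using step.IH perturbation_edge[OF assms x, of k] by (simp add: algebra_simps)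
  qed simp
  \<comment> \<open>The edges end at \<open>\<pi> j x\<close>; the remaining distance to \<open>x\<close> vanishes as \<open>j\<close> decreases, where the
    finite, possibly large norm of \<open>g\<close> is enough.\<close>
  have tail: "\<bar>g x - g (\<pi> k x)\<bar> \<le> e * 2 powi (k + 1)" if x: "x \<in> mspace M" for x k
  proof (rule LIMSEQ_le_const)
    show "(\<lambda>n. e * 2 powi (k + 1) + lip_norm M g * 2 powi (- int n)) \<longlonglongrightarrow> e * 2 powi (k + 1)"
      using tendsto_add[OF tendsto_const tendsto_mult_left[OF tendsto_half_powers, of "lip_norm M g"],
          of "e * 2 powi (k + 1)"] by simp
    have "\<bar>g x - g (\<pi> k x)\<bar> \<le> e * 2 powi (k + 1) + lip_norm M g * 2 powi j" if "j \<le> k" for j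
    proof -
      have "\<bar>g x - g (\<pi> j x)\<bar> \<le> lip_norm M g * mdist M x (\<pi> j x)"
        by (rule lip_norm_bound[OF g x net_in[OF x]])
      also have "\<dots> \<le> lip_norm M g * 2 powi j"
        using net_close[OF x, of j] lip_norm_nonneg[OF g] by (intro mult_left_mono) auto
      finally have "\<bar>g x - g (\<pi> j x)\<bar> \<le> lip_norm M g * 2 powi j" .
      moreover have "0 \<le> e * 2 powi (j + 1)" using e by simp
      ultimately show ?thesis
        using chain[OF x that] by (simp add: right_diff_distrib)
    qed
    then show "\<exists>N. \<forall>n\<ge>N. \<bar>g x - g (\<pi> k x)\<bar> \<le> e * 2 powi (k + 1) + lip_norm M g * 2 powi (- int n)"
      by (intro exI[of _ "nat (- k)"]) auto
  qed
  fix x y assume xy: "x \<in> mspace M" "y \<in> mspace M"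
  show "\<bar>g x - g y\<bar> \<le> 8 * e * mdist M x y"
  proof (cases "x = y")
    case True
    then show ?thesis using e by simp
  next
    case False
    then have "mdist M x y > 0" using xy Metric_space.mdist_pos_eq[OF Metric_space_mspace_mdist] by metis
    then obtain k where k: "2 powi k \<le> mdist M x y" "mdist M x y < 2 powi (k + 1)"
      using powi_scale_exists by blast
    have join: "\<pi> (k + 1) x = \<pi> (k + 1) y"
      using net_eqI[OF xy k(2)] .
    have "\<bar>g x - g y\<bar> \<le> 2 * (e * 2 powi (k + 1 + 1))"
      using tail[OF xy(1), of "k + 1"] tail[OF xy(2), of "k + 1"] join by simp
    also have "\<dots> = 8 * e * 2 powi k"
      using power_int_add_1[of "2::real" k] power_int_add_1[of "2::real" "k + 1"] by simp
    also have "\<dots> \<le> 8 * e * mdist M x y"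
      using k(1) e by (intro mult_left_mono) auto
    finally show ?thesis .
  qed
qed (use e in simp)

end

section \<open>The unit ball of the Lipschitz functions on an ultrametric space\<close>

theorem theorem5p1:
  fixes M :: "'a metric" and b :: 'a
  assumes "ultrametric_space M"
    and "b \<in> mspace M"
    and "mspace M \<noteq> {b}"
  shows "(\<exists>f. strongly_extreme_point (Lip0 M b) (lip_norm M) f) \<and>
         \<not> locally_almost_square (Lip0 M b) (lip_norm M)"
proof -
  obtain \<pi> where "nested_nets M b \<pi>"
    using nested_nets_exist[OF assms(1,2)] by blast
  then interpret nested_nets M b \<pi> .
  have "strongly_extreme_point (Lip0 M b) (lip_norm M) zigzag"
  proof (rule strongly_extreme_pointI)
    show "zigzag \<in> unit_sphere (Lip0 M b) (lip_norm M)"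
      using zigzag_in_Lip0 lip_norm_zigzag[OF assms(3)] by (simp add: unit_sphere_def)
    show "0 \<le> lip_norm M g" if "g \<in> Lip0 M b" for g
      by (rule lip_norm_nonneg[OF that])
    show "lip_norm M g \<le> 8 * e"
      if "g \<in> Lip0 M b" "0 \<le> e" "lip_norm M (zigzag + g) \<le> 1 + e" "lip_norm M (zigzag - g) \<le> 1 + e"
      for g e
      by (rule lip_norm_perturbation_le[OF that])
  qed
  then show ?thesis
    using strongly_extreme_point_imp_not_locally_almost_square[OF normed_space_on_Lip0[OF assms(2)]]
    by metis
qed

end
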